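(* Let $k\ge2$, $m\ge0$, $1\le s\le k$, and $N=mk+s$. Then $$|\mathcal{D}_{N,k}(321)|=\sum_{a=0}^{\lfloor N/2\rfloor}K_{N,k}(a)\,\frac{N-2a+1}{N-a+1}\binom{N}{a}.$$
   Context: For $\pi=\pi_1\cdots\pi_N\in S_N$ let $\operatorname{Des}(\pi)=\{i\in[N-1]:\pi_i>\pi_{i+1}\}$. For $k\ge2$, $N\ge1$, let $\mathcal{D}_{N,k}=\{\pi\in S_N:\operatorname{Des}(\pi)=\{k,2k,\ldots,k\lfloor (N-1)/k\rfloor\}\}$. $\mathcal{D}_{N,k}(321)$ is the set of elements of $\mathcal{D}_{N,k}$ having no decreasing subsequence of length three. A ballot word of length $N$ is a word $w_1\cdots w_N$ in the letters $U,D$ such that every prefix contains at least as many $U$'s as $D$'s. It has a peak $UD$ at position $i$ if $w_i=U$ and $w_{i+1}=D$. $K_{N,k}(a)$ is the number of ballot words of length $N=mk+s$ with exactly $a$ letters $D$ such that the set of positions of its peaks $UD$ is exactly $\{k,2k,\ldots,km\}$. *)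

theory Defs
  imports Complex_Main "HOL-Combinatorics.Permutations"
begin

text \<open>A permutation in \<open>S\<^sub>N\<close> is a function \<open>p\<close> with \<open>p permutes {1..N}\<close>, and its one-line notation
  is \<open>p 1, \<dots>, p N\<close>.\<close>

definition Des :: "nat \<Rightarrow> (nat \<Rightarrow> nat) \<Rightarrow> nat set" where
  "Des N p = {i. 1 \<le> i \<and> i < N \<and> p i > p (i + 1)}"

definition multiples_upto :: "nat \<Rightarrow> nat \<Rightarrow> nat set" where
  "multiples_upto k m = {k * j | j. 1 \<le> j \<and> j \<le> m}"

definition des_perms :: "nat \<Rightarrow> nat \<Rightarrow> (nat \<Rightarrow> nat) set" where
  "des_perms N k = {p. p permutes {1..N} \<and> Des N p = multiples_upto k ((N - 1) div k)}"

definition avoids_321 :: "nat \<Rightarrow> (nat \<Rightarrow> nat) \<Rightarrow> bool" where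
  "avoids_321 N p \<longleftrightarrow>
     \<not> (\<exists>i j l. 1 \<le> i \<and> i < j \<and> j < l \<and> l \<le> N \<and> p i > p j \<and> p j > p l)"

definition des_perms_321 :: "nat \<Rightarrow> nat \<Rightarrow> (nat \<Rightarrow> nat) set" where
  "des_perms_321 N k = {p \<in> des_perms N k. avoids_321 N p}"

datatype letter = U | D

definition ballot :: "letter list \<Rightarrow> bool" where
  "ballot w \<longleftrightarrow> (\<forall>j \<le> length w. count_list (take j w) D \<le> count_list (take j w) U)"

text \<open>Positions in a word are counted from 1, so the letter at position \<open>i\<close> is \<open>w ! (i - 1)\<close>.\<close>

definition peaks :: "letter list \<Rightarrow> nat set" where
  "peaks w = {i. 1 \<le> i \<and> i < length w \<and> w ! (i - 1) = U \<and> w ! i = D}"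

text \<open>If \<open>N = m * k + s\<close> with \<open>1 \<le> s \<le> k\<close>, then \<open>m = (N - 1) div k\<close>.\<close>

definition K :: "nat \<Rightarrow> nat \<Rightarrow> nat \<Rightarrow> nat" where
  "K N k a = card {w. length w = N \<and> ballot w \<and> count_list w D = a
                     \<and> peaks w = multiples_upto k ((N - 1) div k)}"

end

theory Submission
  imports Defs
begin

text \<open>Weight each ballot word with peak set \<open>S\<close> by the number of ballot words of the same length and
  final height. It suffices to compare, for every \<open>S \<subseteq> {1..N - 1}\<close>, the number of 321-avoiding
  permutations whose descent set contains \<open>S\<close> with the total weight of the ballot words whose peak set
  contains \<open>S\<close>. Both vanish if \<open>S\<close> contains two consecutive numbers, and otherwise both are the
  Catalan number of index \<open>N - card S\<close>: on the permutation side a forced descent merges two letters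
  into one in the Lehmer code, and on the ballot side a forced peak \<open>UD\<close> can be deleted, which leaves
  pairs of paths of lengths \<open>N - 2 * card S\<close> and \<open>N\<close> that meet at their final height.\<close>

subsection \<open>Inversion over supersets\<close>

text \<open>Downward induction from \<open>E\<close>: the sum over all supersets of \<open>S\<close>
  is the fibre at \<open>S\<close> plus the fibres at strictly larger sets, which agree by
  induction. No alternating signs occur, so the argument stays in the natural numbers.\<close>

lemma sum_fibres_eqI:
  fixes f :: "'a \<Rightarrow> nat" and g :: "'b \<Rightarrow> nat" and p :: "'a \<Rightarrow> 'c set" and q :: "'b \<Rightarrow> 'c set"
  assumes "finite X" "finite Y" "finite E"
    and pE: "\<And>x. x \<in> X \<Longrightarrow> p x \<subseteq> E" and qE: "\<And>y. y \<in> Y \<Longrightarrow> q y \<subseteq> E"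
    and sup: "\<And>S. S \<subseteq> E \<Longrightarrow>
      (\<Sum>x | x \<in> X \<and> S \<subseteq> p x. f x) = (\<Sum>y | y \<in> Y \<and> S \<subseteq> q y. g y)"
    and "S \<subseteq> E"
  shows "(\<Sum>x | x \<in> X \<and> p x = S. f x) = (\<Sum>y | y \<in> Y \<and> q y = S. g y)"
  using \<open>S \<subseteq> E\<close>
proof (induction "card (E - S)" arbitrary: S rule: less_induct)
  case less
  define R where "R = {S'. S \<subset> S' \<and> S' \<subseteq> E}"
  have finR: "finite R" unfolding R_def using \<open>finite E\<close> by simp
  have split: "(\<Sum>z | z \<in> Z \<and> S \<subseteq> r z. w z)
      = (\<Sum>z | z \<in> Z \<and> r z = S. w z) + (\<Sum>S'\<in>R. \<Sum>z | z \<in> Z \<and> r z = S'. w z)"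
    if "finite Z" "\<And>z. z \<in> Z \<Longrightarrow> r z \<subseteq> E" for Z :: "'d set" and r and w :: "'d \<Rightarrow> nat"
  proof -
    have "{z. z \<in> Z \<and> S \<subseteq> r z} = {z. z \<in> Z \<and> r z = S} \<union> {z. z \<in> Z \<and> r z \<in> R}"
      using that(2) by (auto simp: R_def)
    then have "(\<Sum>z | z \<in> Z \<and> S \<subseteq> r z. w z)
        = (\<Sum>z | z \<in> Z \<and> r z = S. w z) + (\<Sum>z | z \<in> Z \<and> r z \<in> R. w z)"
      using that(1) by (auto intro!: sum.union_disjoint simp: R_def)
    also have "(\<Sum>z | z \<in> Z \<and> r z \<in> R. w z)
        = (\<Sum>S'\<in>R. \<Sum>z | z \<in> {z. z \<in> Z \<and> r z \<in> R} \<and> r z = S'. w z)"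
      using that(1) finR by (intro sum.group[symmetric]) auto
    also have "\<dots> = (\<Sum>S'\<in>R. \<Sum>z | z \<in> Z \<and> r z = S'. w z)"
      by (intro sum.cong) auto
    finally show ?thesis .
  qed
  have "(\<Sum>S'\<in>R. \<Sum>x | x \<in> X \<and> p x = S'. f x) = (\<Sum>S'\<in>R. \<Sum>y | y \<in> Y \<and> q y = S'. g y)"
  proof (intro sum.cong refl)
    fix S' assume "S' \<in> R"
    then have "card (E - S') < card (E - S)" "S' \<subseteq> E"
      using \<open>finite E\<close> less.prems by (auto simp: R_def intro!: psubset_card_mono)
    then show "(\<Sum>x | x \<in> X \<and> p x = S'. f x) = (\<Sum>y | y \<in> Y \<and> q y = S'. g y)"
      by (rule less.hyps)
  qed
  then show ?case
    using sup[OF less.prems] split[of X p f] split[of Y q g] assms(1,2) pE qE by simp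
qed


subsection \<open>Words in reverse order\<close>

text \<open>From here on words are stored as lists with the last letter first, so that removing the last
  letter, at position \<open>length xs\<close>, is removing the head.\<close>

fun rel_positions :: "('a \<Rightarrow> 'a \<Rightarrow> bool) \<Rightarrow> 'a list \<Rightarrow> nat set" where
  "rel_positions P (x # y # ys) =
     (if P y x then insert (Suc (length ys)) (rel_positions P (y # ys)) else rel_positions P (y # ys))"
| "rel_positions P _ = {}"

text \<open>Ties the recursion to positions in reading order: \<open>P\<close> takes the earlier
  letter first, so \<open>(>)\<close> yields descents and \<open>(<)\<close> yields ascents.\<close>

lemma rel_positions_rev:
  "rel_positions P xs
     = {i. 1 \<le> i \<and> i < length xs \<and> P (rev xs ! (i - 1)) (rev xs ! i)}"
proof (induction P xs rule: rel_positions.induct)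
  case (1 P x y ys)
  have "{i. 1 \<le> i \<and> i < length (x # y # ys) \<and> P (rev (x # y # ys) ! (i - 1)) (rev (x # y # ys) ! i)}
     = {i. 1 \<le> i \<and> i < length (y # ys) \<and> P (rev (y # ys) ! (i - 1)) (rev (y # ys) ! i)}
       \<union> {i. i = Suc (length ys) \<and> P y x}" (is "?A = ?B \<union> ?C")
  proof (intro set_eqI)
    fix i
    consider "i = 0" | "0 < i" "i < Suc (length ys)" | "i = Suc (length ys)" | "i > Suc (length ys)" by linarith
    then show "i \<in> ?A \<longleftrightarrow> i \<in> ?B \<union> ?C"
    proof cases
      case 2
      then have "rev (x # y # ys) ! i = rev (y # ys) ! i"
        "rev (x # y # ys) ! (i - 1) = rev (y # ys) ! (i - 1)"
        by (auto simp only: rev.simps(2)[of x] nth_append length_rev length_Cons split: if_splits)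
      with 2 show ?thesis by simp
    qed (auto simp: nth_append)
  qed
  then show ?case using 1 by auto
qed auto

lemma rel_positions_subset: "rel_positions P xs \<subseteq> {1..<length xs}"
  by (auto simp: rel_positions_rev)

lemma rel_positions_Cons:
  "S \<subseteq> {1..<length xs} \<Longrightarrow> S \<subseteq> rel_positions P (x # xs) \<longleftrightarrow> S \<subseteq> rel_positions P xs"
  by (cases xs) auto

text \<open>The pair joining \<open>y\<close> to \<open>xs\<close> sits at position
  \<open>length xs\<close>, outside \<open>S\<close>, so it is unconstrained. This is what lets a
  domino be peeled off a word.\<close>

lemma rel_positions_Cons_Cons:
  assumes "S \<subseteq> {1..<length xs}"
  shows "insert (Suc (length xs)) S \<subseteq> rel_positions P (x # y # xs) \<longleftrightarrow>
     P y x \<and> S \<subseteq> rel_positions P xs"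
proof -
  have "Suc (length xs) \<notin> rel_positions P (y # xs)"
    using rel_positions_subset[of P "y # xs"] by auto
  moreover have "Suc (length xs) \<notin> S" using assms by auto
  ultimately show ?thesis
    using rel_positions_Cons[OF assms, of P y] by auto
qed

text \<open>\<open>tiling n S a d\<close>: the interval \<open>{1..n}\<close> is tiled by \<open>a\<close> monominoes and \<open>d\<close> dominoes, and \<open>S\<close>
  is the set of left ends of the dominoes.\<close>

inductive tiling :: "nat \<Rightarrow> nat set \<Rightarrow> nat \<Rightarrow> nat \<Rightarrow> bool" where
  empty: "tiling 0 {} 0 0"
| mono: "tiling n S a d \<Longrightarrow> tiling (Suc n) S (Suc a) d"
| domino: "tiling n S a d \<Longrightarrow> tiling (Suc (Suc n)) (insert (Suc n) S) a (Suc d)"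

lemma tiling_subset: "tiling n S a d \<Longrightarrow> S \<subseteq> {1..<n}"
  by (induction rule: tiling.induct) (auto simp: subset_iff less_Suc_eq)

lemma tiling_length: "tiling n S a d \<Longrightarrow> n = a + 2 * d"
  by (induction rule: tiling.induct) auto

lemma tiling_exists:
  "S \<subseteq> {1..<n} \<Longrightarrow> \<forall>i\<in>S. Suc i \<notin> S \<Longrightarrow> \<exists>a d. tiling n S a d"
proof (induction n arbitrary: S rule: less_induct)
  case (less n)
  show ?case
  proof (cases n)
    case 0
    then show ?thesis using less.prems tiling.empty by auto
  next
    case (Suc m)
    show ?thesis
    proof (cases "m \<in> S")
      case False
      with less.prems Suc have "S \<subseteq> {1..<m}" by (force simp: less_Suc_eq)
      with less.IH[of m S] less.prems Suc show ?thesis by (auto intro: tiling.mono)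
    next
      case True
      \<comment> \<open>The tiling ends with a domino on \<open>m\<close> and \<open>n\<close>,
        preceded by \<open>l = m - 1\<close> cells; \<open>l\<close> is no left end because
        \<open>S\<close> has no two consecutive elements.\<close>
      with less.prems obtain l where m: "m = Suc l" by (cases m) auto
      have "x \<in> {1..<l}" if "x \<in> S - {m}" for x
      proof -
        have "x < Suc m" "1 \<le> x" "x \<noteq> m" using that less.prems(1) Suc by auto
        moreover have "x \<noteq> l" using that True less.prems(2) m by auto
        ultimately show ?thesis using m by simp
      qed
      then have "S - {m} \<subseteq> {1..<l}" by blast
      with less.IH[of l "S - {m}"] less.prems Suc m obtain a d where "tiling l (S - {m}) a d" by auto
      from tiling.domino[OF this] show ?thesis using True Suc m by (auto simp: insert_absorb)
    qed
  qed
qed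


subsection \<open>Lehmer codes of 321-avoiding permutations\<close>

text \<open>The tail holds the earlier letters, so this is the Lehmer code that counts, for each
  letter, the larger letters to its left.\<close>

fun code :: "nat list \<Rightarrow> nat list" where
  "code [] = []"
| "code (x # xs) = card {y \<in> set xs. x < y} # code xs"

text \<open>The number of values above the largest inversion bottom; an element appended to a 321-avoiding
  word may exceed all of its letters, or be smaller than at most that many.\<close>

fun reach :: "nat list \<Rightarrow> nat" where
  "reach [] = 0"
| "reach (c # cs) = (if c = 0 then Suc (reach cs) else c)"

fun valid :: "nat list \<Rightarrow> bool" where
  "valid [] = True"
| "valid (c # cs) = (valid cs \<and> c \<le> reach cs)"

fun bottoms :: "nat list \<Rightarrow> nat set" where
  "bottoms [] = {}"
| "bottoms (x # xs) = (if \<exists>y\<in>set xs. x < y then insert x (bottoms xs) else bottoms xs)"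

fun avoids :: "nat list \<Rightarrow> bool" where
  "avoids [] = True"
| "avoids (x # xs) = (avoids xs \<and> (\<forall>b\<in>bottoms xs. b \<le> x))"

lemma length_code [simp]: "length (code xs) = length xs"
  by (induction xs) auto

lemma bottoms_subset: "bottoms xs \<subseteq> set xs"
  by (induction xs) auto

lemma reach_le_length: "valid cs \<Longrightarrow> reach cs \<le> length cs"
  by (induction cs) auto

lemma valid_le_length: "valid cs \<Longrightarrow> c \<in> set cs \<Longrightarrow> c \<le> length cs"
  by (induction cs) (auto dest: reach_le_length)

text \<open>If \<open>x\<close> lies below an earlier letter, it becomes the largest inversion
  bottom, and the letters above it are those its code entry counts. Otherwise \<open>x\<close> is a
  new maximum, and it joins the letters above all bottoms.\<close>

lemma reach_code:
  "distinct xs \<Longrightarrow> avoids xs \<Longrightarrow> reach (code xs) = card {z \<in> set xs. \<forall>b\<in>bottoms xs. b < z}"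
proof (induction xs)
  case (Cons x xs)
  show ?case
  proof (cases "\<exists>y\<in>set xs. x < y")
    case True
    then have ne: "card {y \<in> set xs. x < y} \<noteq> 0" by auto
    have "bottoms (x # xs) = insert x (bottoms xs)" using True by simp
    then have "{z \<in> set (x # xs). \<forall>b\<in>bottoms (x # xs). b < z} = {y \<in> set xs. x < y}"
      using Cons.prems by (auto dest: le_less_trans)
    with ne show ?thesis by (simp only: code.simps reach.simps if_False)
  next
    case False
    then have lt: "y < x" if "y \<in> set xs" for y
      using that Cons.prems by (metis distinct.simps(2) linorder_neqE_nat)
    have "{z \<in> set (x # xs). \<forall>b\<in>bottoms (x # xs). b < z}
        = insert x {z \<in> set xs. \<forall>b\<in>bottoms xs. b < z}"
      using False lt bottoms_subset[of xs] by auto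
    moreover have "{y \<in> set xs. x < y} = {}" using False by auto
    ultimately show ?thesis using Cons by simp
  qed
qed simp

text \<open>The letters above \<open>x\<close> and the letters above all bottoms are both up-sets of
  \<open>set xs\<close>, so comparing their sizes decides whether some bottom exceeds
  \<open>x\<close>, that is, whether \<open>x\<close> completes a 321.\<close>

lemma valid_code: "distinct xs \<Longrightarrow> valid (code xs) \<longleftrightarrow> avoids xs"
proof (induction xs)
  case (Cons x xs)
  have "card {y \<in> set xs. x < y} \<le> reach (code xs) \<longleftrightarrow> (\<forall>b\<in>bottoms xs. b \<le> x)" if av: "avoids xs"
  proof
    assume le: "card {y \<in> set xs. x < y} \<le> reach (code xs)"
    show "\<forall>b\<in>bottoms xs. b \<le> x"
    proof (rule ccontr)
      assume "\<not> ?thesis"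
      then obtain b where "b \<in> bottoms xs" "x < b" by auto
      then have "{z \<in> set xs. \<forall>b\<in>bottoms xs. b < z} \<subset> {y \<in> set xs. x < y}"
        using bottoms_subset[of xs] by force
      then have "reach (code xs) < card {y \<in> set xs. x < y}"
        using reach_code[OF _ av] Cons.prems by (simp add: psubset_card_mono)
      with le show False by simp
    qed
  next
    assume "\<forall>b\<in>bottoms xs. b \<le> x"
    then have "{y \<in> set xs. x < y} \<subseteq> {z \<in> set xs. \<forall>b\<in>bottoms xs. b < z}" by force
    then show "card {y \<in> set xs. x < y} \<le> reach (code xs)"
      using reach_code av Cons.prems by (auto intro: card_mono)
  qed
  with Cons show ?case by auto
qed simp

text \<open>If \<open>x < y\<close> with \<open>y\<close> just before \<open>x\<close>, then
  \<open>x\<close> is exceeded by \<open>y\<close> itself and by every letter exceeding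
  \<open>y\<close>. Descents of a word thus become ascents of its code.\<close>

lemma rel_positions_code:
  "distinct xs \<Longrightarrow> rel_positions (<) (code xs) = rel_positions (>) xs"
proof (induction "(>) :: nat \<Rightarrow> nat \<Rightarrow> bool" xs rule: rel_positions.induct)
  case (1 x y ys)
  have "card {z \<in> set ys. y < z} < card {z \<in> set (y # ys). x < z} \<longleftrightarrow> x < y"
  proof
    assume "x < y"
    then have "{z \<in> set ys. y < z} \<subset> {z \<in> set (y # ys). x < z}" using 1 by auto
    then show "card {z \<in> set ys. y < z} < card {z \<in> set (y # ys). x < z}"
      by (auto intro: psubset_card_mono)
  next
    assume lt: "card {z \<in> set ys. y < z} < card {z \<in> set (y # ys). x < z}"
    show "x < y"
    proof (rule ccontr)
      assume "\<not> x < y"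
      then have "{z \<in> set (y # ys). x < z} \<subseteq> {z \<in> set ys. y < z}" by auto
      then have "card {z \<in> set (y # ys). x < z} \<le> card {z \<in> set ys. y < z}"
        by (auto intro: card_mono)
      with lt show False by simp
    qed
  qed
  with 1 show ?case by auto
qed auto

lemma bij_betw_card_greater:
  assumes "finite (A :: nat set)"
  shows "bij_betw (\<lambda>v. card {y \<in> A. v < y}) A {..<card A}"
proof -
  have less: "card {y \<in> A. w < y} < card {y \<in> A. v < y}" if "v \<in> A" "w \<in> A" "v < w" for v w
    using assms that by (intro psubset_card_mono) force+
  have inj: "inj_on (\<lambda>v. card {y \<in> A. v < y}) A"
    by (intro linorder_inj_onI' less_imp_neq[THEN not_sym] less)
  moreover have "card {y \<in> A. v < y} < card A" if "v \<in> A" for v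
    using assms that by (intro psubset_card_mono) auto
  then have "(\<lambda>v. card {y \<in> A. v < y}) ` A \<subseteq> {..<card A}" by auto
  ultimately show ?thesis
    using card_image[OF inj] by (simp add: bij_betw_def card_subset_eq)
qed

text \<open>The newest code entry is the rank from the top of the last letter in \<open>A\<close>,
  which determines that letter; the rest follows by induction. A general \<open>A\<close> is
  required since deleting the letter leaves a gap.\<close>

lemma code_unique:
  "finite A \<Longrightarrow> length cs = card A \<Longrightarrow> valid cs \<Longrightarrow> \<exists>!xs. distinct xs \<and> set xs = A \<and> code xs = cs"
proof (induction cs arbitrary: A)
  case Nil
  then show ?case by (intro ex1I[of _ "[]"]) auto
next
  case (Cons c cs)
  have "c \<in> {..<card A}" using Cons.prems reach_le_length[of cs] by auto
  then have "c \<in> (\<lambda>v. card {y \<in> A. v < y}) ` A"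
    using bij_betw_imp_surj_on[OF bij_betw_card_greater[OF Cons.prems(1)]] by simp
  then obtain v where v: "v \<in> A" "card {y \<in> A. v < y} = c" by blast
  have v_unique: "v' = v" if "v' \<in> A" "card {y \<in> A. v' < y} = c" for v'
    using bij_betw_card_greater[OF Cons.prems(1)] v that by (auto simp: bij_betw_def inj_on_def)
  have rm: "{y \<in> B - {u}. u < y} = {y \<in> B. u < y}" for B and u :: nat by auto
  have "\<exists>!xs. distinct xs \<and> set xs = A - {v} \<and> code xs = cs"
    using Cons.prems v by (intro Cons.IH) auto
  then obtain xs where xs: "distinct xs" "set xs = A - {v}" "code xs = cs"
    and xs_unique: "\<And>ys. distinct ys \<Longrightarrow> set ys = A - {v} \<Longrightarrow> code ys = cs \<Longrightarrow> ys = xs"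
    by blast
  show ?case
  proof (intro ex1I[of _ "v # xs"])
    have "{y. (y \<in> A \<and> y \<noteq> v) \<and> v < y} = {y \<in> A. v < y}" by auto
    then show "distinct (v # xs) \<and> set (v # xs) = A \<and> code (v # xs) = c # cs"
      using v xs by auto
  next
    fix zs assume zs: "distinct zs \<and> set zs = A \<and> code zs = c # cs"
    then obtain u ys where u: "zs = u # ys" by (cases zs) auto
    with zs have ys: "set ys = A - {u}" and "u \<in> A" by auto
    with zs u rm[of A u] have "card {y \<in> A. u < y} = c" by simp
    with \<open>u \<in> A\<close> have "u = v" by (rule v_unique)
    with u ys zs xs_unique[of ys] show "zs = v # xs" by auto
  qed
qed

definition codes :: "nat \<Rightarrow> nat list set" where
  "codes n = {cs. length cs = n \<and> valid cs}"

lemma finite_codes: "finite (codes n)"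
proof -
  have "codes n \<subseteq> {cs. set cs \<subseteq> {..n} \<and> length cs = n}"
    using valid_le_length by (auto simp: codes_def)
  then show ?thesis by (rule finite_subset) (simp add: finite_lists_length_eq)
qed

section \<open>From permutations to codes through one-line notation\<close>

lemma bottoms_iff:
  "b \<in> bottoms (rev ys) \<longleftrightarrow> (\<exists>j<length ys. b = ys ! j \<and> (\<exists>i<j. ys ! j < ys ! i))"
proof (induction ys rule: rev_induct)
  case (snoc y ys)
  have "(\<exists>j<length (ys @ [y]). b = (ys @ [y]) ! j \<and> (\<exists>i<j. (ys @ [y]) ! j < (ys @ [y]) ! i))
      \<longleftrightarrow> (\<exists>j<length ys. b = ys ! j \<and> (\<exists>i<j. ys ! j < ys ! i)) \<or> b = y \<and> (\<exists>i<length ys. y < ys ! i)"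
    by (simp add: Ex_less_Suc nth_append disj_commute cong: conj_cong)
  moreover have "b \<in> bottoms (rev (ys @ [y])) \<longleftrightarrow>
      b \<in> bottoms (rev ys) \<or> b = y \<and> (\<exists>x\<in>set ys. y < x)"
    by auto
  moreover have "(\<exists>x\<in>set ys. y < x) \<longleftrightarrow> (\<exists>i<length ys. y < ys ! i)"
    by (metis in_set_conv_nth)
  ultimately show ?case using snoc by (simp only:)
qed simp

lemma avoids_iff:
  "avoids (rev ys) \<longleftrightarrow>
     \<not> (\<exists>l<length ys. \<exists>j<l. ys ! l < ys ! j \<and> (\<exists>i<j. ys ! j < ys ! i))"
proof (induction ys rule: rev_induct)
  case (snoc y ys)
  have "(\<exists>l<length (ys @ [y]). \<exists>j<l. (ys @ [y]) ! l < (ys @ [y]) ! j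
           \<and> (\<exists>i<j. (ys @ [y]) ! j < (ys @ [y]) ! i))
      \<longleftrightarrow> (\<exists>l<length ys. \<exists>j<l. ys ! l < ys ! j \<and> (\<exists>i<j. ys ! j < ys ! i))
        \<or> (\<exists>j<length ys. y < ys ! j \<and> (\<exists>i<j. ys ! j < ys ! i))"
    by (simp add: Ex_less_Suc nth_append disj_commute cong: conj_cong)
  moreover have "(\<forall>b\<in>bottoms (rev ys). b \<le> y)
      \<longleftrightarrow> \<not> (\<exists>j<length ys. y < ys ! j \<and> (\<exists>i<j. ys ! j < ys ! i))"
  proof -
    have "(\<forall>b\<in>bottoms (rev ys). b \<le> y) \<longleftrightarrow> \<not> (\<exists>b. b \<in> bottoms (rev ys) \<and> y < b)"
      by (auto simp: not_less)
    then show ?thesis unfolding bottoms_iff by blast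
  qed
  ultimately show ?case using snoc by simp
qed simp

definition one_line :: "nat \<Rightarrow> (nat \<Rightarrow> nat) \<Rightarrow> nat list" where
  "one_line N p = map p [1..<Suc N]"

lemma length_one_line [simp]: "length (one_line N p) = N"
  by (simp add: one_line_def)

lemma nth_one_line [simp]: "i < N \<Longrightarrow> one_line N p ! i = p (Suc i)"
  by (simp add: one_line_def del: upt_Suc)

lemma bij_betw_one_line:
  "bij_betw (one_line N) {p. p permutes {1..N}} {xs. distinct xs \<and> set xs = {1..N}}"
proof (intro bij_betw_imageI inj_onI)
  fix p q assume p: "p \<in> {p. p permutes {1..N}}" and q: "q \<in> {p. p permutes {1..N}}"
    and eq: "one_line N p = one_line N q"
  show "p = q"
  proof
    fix i show "p i = q i"
    proof (cases "i \<in> {1..N}")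
      case True
      then have "i - 1 < N" by auto
      with True nth_one_line[of "i - 1" N p] nth_one_line[of "i - 1" N q] eq show ?thesis by simp
    next
      case False
      with p q show ?thesis by (simp add: permutes_not_in del: atLeastAtMost_iff)
    qed
  qed
next
  have set_upt': "set [1..<Suc N] = {1..N}" by auto
  show "one_line N ` {p. p permutes {1..N}} = {xs. distinct xs \<and> set xs = {1..N}}"
  proof (intro equalityI subsetI)
    fix xs assume "xs \<in> one_line N ` {p. p permutes {1..N}}"
    then obtain p where p: "p permutes {1..N}" and xs: "xs = one_line N p" by auto
    have "distinct xs"
      unfolding xs one_line_def distinct_map set_upt' using permutes_inj_on[OF p] by simp
    moreover have "set xs = {1..N}"
      unfolding xs one_line_def set_map set_upt' using permutes_image[OF p] by simp
    ultimately show "xs \<in> {xs. distinct xs \<and> set xs = {1..N}}" by simp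
  next
    fix xs assume "xs \<in> {xs. distinct xs \<and> set xs = {1..N}}"
    then have d: "distinct xs" and s: "set xs = {1..N}" by auto
    from d s have l: "length xs = N" using distinct_card by fastforce
    define p where "p i = (if i \<in> {1..N} then xs ! (i - 1) else i)" for i
    have ol: "one_line N p = xs"
      by (intro nth_equalityI) (auto simp: l p_def)
    have "p ` {1..N} = {1..N}"
      using arg_cong[OF ol, of set] s unfolding one_line_def set_map set_upt' by simp
    then have "bij_betw p {1..N} {1..N}"
      by (simp add: bij_betw_def eq_card_imp_inj_on)
    then have "p permutes {1..N}"
      by (rule bij_imp_permutes) (auto simp: p_def)
    with ol show "xs \<in> one_line N ` {p. p permutes {1..N}}" by blast
  qed
qed

lemma Des_one_line: "Des N p = rel_positions (>) (rev (one_line N p))"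
proof -
  have "p i = one_line N p ! (i - 1)" "p (i + 1) = one_line N p ! i" if "1 \<le> i" "i < N" for i
    using that by auto
  then show ?thesis by (auto simp: Des_def rel_positions_rev)
qed

lemma avoids_321_one_line: "avoids_321 N p \<longleftrightarrow> avoids (rev (one_line N p))"
proof -
  have "(\<exists>i j l. 1 \<le> i \<and> i < j \<and> j < l \<and> l \<le> N \<and> p i > p j \<and> p j > p l) \<longleftrightarrow>
    (\<exists>l<N. \<exists>j<l. p (Suc l) < p (Suc j) \<and> (\<exists>i<j. p (Suc j) < p (Suc i)))" (is "?L \<longleftrightarrow> ?R")
  proof
    assume ?L
    then obtain i j l where "1 \<le> i" "i < j" "j < l" "l \<le> N" "p i > p j" "p j > p l" by blast
    then have "l - 1 < N" "j - 1 < l - 1" "p (Suc (l - 1)) < p (Suc (j - 1))" "i - 1 < j - 1"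
      "p (Suc (j - 1)) < p (Suc (i - 1))"
      by simp_all
    then show ?R by blast
  next
    assume ?R
    then obtain i j l where "l < N" "j < l" "p (Suc l) < p (Suc j)" "i < j" "p (Suc j) < p (Suc i)"
      by blast
    then show ?L
      by (intro exI[of _ "Suc i"] exI[of _ "Suc j"] exI[of _ "Suc l"]) simp
  qed
  also have "?R \<longleftrightarrow> (\<exists>l<length (one_line N p). \<exists>j<l. one_line N p ! l < one_line N p ! j \<and>
      (\<exists>i<j. one_line N p ! j < one_line N p ! i))"
    by (simp cong: conj_cong)
  finally show ?thesis
    unfolding avoids_321_def avoids_iff by (rule arg_cong)
qed

lemma card_avoiding_perms:
  "card {p. p permutes {1..N} \<and> Des N p = S \<and> avoids_321 N p}
     = card {cs \<in> codes N. rel_positions (<) cs = S}"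
proof -
  let ?P = "{p. p permutes {1..N} \<and> Des N p = S \<and> avoids_321 N p}"
  let ?C = "{cs \<in> codes N. rel_positions (<) cs = S}"
  let ?X = "{xs. distinct xs \<and> set xs = {1..N} \<and> rel_positions (>) (rev xs) = S \<and> avoids (rev xs)}"
  let ?f = "\<lambda>xs. code (rev xs)"
  have "bij_betw (one_line N) ?P ?X"
    using bij_betw_Collect[OF bij_betw_one_line, of N
        "\<lambda>xs. rel_positions (>) (rev xs) = S \<and> avoids (rev xs)" "\<lambda>p. Des N p = S \<and> avoids_321 N p"]
    by (simp add: Des_one_line avoids_321_one_line)
  moreover have "bij_betw ?f ?X ?C"
  proof (intro bij_betw_imageI inj_onI)
    fix xs ys assume xs: "xs \<in> ?X" and ys: "ys \<in> ?X" and eq: "?f xs = ?f ys"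
    have "length (?f xs) = card {1..N}" "valid (?f xs)"
      using xs valid_code[of "rev xs"] distinct_card[of xs] by auto
    from code_unique[OF finite_atLeastAtMost this] obtain zs
      where "\<And>us. distinct us \<and> set us = {1..N} \<and> code us = ?f xs \<Longrightarrow> us = zs"
      by (elim ex1E) blast
    from this[of "rev xs"] this[of "rev ys"] xs ys eq have "rev xs = rev ys" by simp
    then show "xs = ys" by simp
  next
    show "?f ` ?X = ?C"
    proof (intro equalityI subsetI)
      fix cs assume "cs \<in> ?f ` ?X"
      then obtain xs where xs: "xs \<in> ?X" and cs: "cs = ?f xs" by auto
      then show "cs \<in> ?C"
        using valid_code[of "rev xs"] rel_positions_code[of "rev xs"] distinct_card[of xs]
        by (auto simp: codes_def)
    next
      fix cs assume cs: "cs \<in> ?C"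
      then have "length cs = card {1..N}" "valid cs" by (auto simp: codes_def)
      from code_unique[OF _ this] obtain xs where xs: "distinct xs" "set xs = {1..N}" "code xs = cs"
        by auto
      with cs valid_code[of xs] rel_positions_code[of xs] have "rev xs \<in> ?X"
        by (auto simp: codes_def)
      moreover have "cs = ?f (rev xs)" using xs by simp
      ultimately show "cs \<in> ?f ` ?X" by (rule rev_image_eqI)
    qed
  qed
  ultimately show ?thesis by (rule trans[OF bij_betw_same_card bij_betw_same_card])
qed


subsection \<open>Codes with prescribed descents\<close>

text \<open>Transfer operator on functions of the reach: its value at \<open>h\<close> sums
  \<open>\<phi>\<close> over the reaches attainable from \<open>h\<close> by one tile.\<close>

definition code_step :: "(nat \<Rightarrow> nat) \<Rightarrow> nat \<Rightarrow> nat" where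
  "code_step \<phi> h = (\<Sum>c = 1..Suc h. \<phi> c)"

text \<open>Appending one letter moves the reach from \<open>h\<close> to any value in \<open>{1..h + 1}\<close>, and so does
  appending two letters that form a descent: the first one must raise the reach to \<open>h + 1\<close>, the
  second one must not raise it.\<close>

lemma sum_codes_tiling:
  "tiling n S a d \<Longrightarrow>
    (\<Sum>cs | cs \<in> codes n \<and> S \<subseteq> rel_positions (<) cs. \<phi> (reach cs)) = (code_step ^^ (a + d)) \<phi> 0"
proof (induction arbitrary: \<phi> rule: tiling.induct)
  case empty
  have "{cs. cs \<in> codes 0 \<and> {} \<subseteq> rel_positions (<) cs} = {[]}" by (auto simp: codes_def)
  then show ?case by simp
next
  case (mono n S a d)
  let ?C = "{cs. cs \<in> codes n \<and> S \<subseteq> rel_positions (<) cs}"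
  have fin: "finite ?C" using finite_codes by simp
  have S: "S \<subseteq> {1..<n}" using tiling_subset[OF mono.hyps] .
  have eq: "{cs. cs \<in> codes (Suc n) \<and> S \<subseteq> rel_positions (<) cs}
      = (\<lambda>(cs, c). c # cs) ` (SIGMA cs : ?C. {..reach cs})" (is "?A = ?B")
  proof (intro equalityI subsetI)
    fix cs assume "cs \<in> ?A"
    then obtain c cs' where c: "cs = c # cs'" "length cs' = n" "valid cs'" "c \<le> reach cs'"
      by (cases cs) (auto simp: codes_def)
    with \<open>cs \<in> ?A\<close> S rel_positions_Cons[of S cs' "(<)" c] have "cs' \<in> ?C"
      by (auto simp: codes_def)
    with c show "cs \<in> ?B" by force
  next
    fix cs assume "cs \<in> ?B"
    then obtain c cs' where c: "cs = c # cs'" "cs' \<in> ?C" "c \<le> reach cs'" by auto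
    with S rel_positions_Cons[of S cs' "(<)" c] show "cs \<in> ?A" by (auto simp: codes_def)
  qed
  have "(\<Sum>cs\<in>?A. \<phi> (reach cs))
      = (\<Sum>x\<in>(SIGMA cs : ?C. {..reach cs}). \<phi> (reach (snd x # fst x)))"
    unfolding eq by (subst sum.reindex) (auto simp: inj_on_def split_beta)
  also have "\<dots> = (\<Sum>cs\<in>?C. \<Sum>c\<le>reach cs. \<phi> (reach (c # cs)))"
    using fin by (simp add: sum.Sigma split_beta)
  also have "\<dots> = (\<Sum>cs\<in>?C. code_step \<phi> (reach cs))"
  proof (intro sum.cong refl)
    fix cs
    have "{..reach cs} = insert 0 {1..reach cs}" by auto
    then have "(\<Sum>c\<le>reach cs. \<phi> (reach (c # cs)))
        = \<phi> (Suc (reach cs)) + (\<Sum>c = 1..reach cs. \<phi> (reach (c # cs)))"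
      by simp
    also have "(\<Sum>c = 1..reach cs. \<phi> (reach (c # cs))) = (\<Sum>c = 1..reach cs. \<phi> c)"
      by (intro sum.cong) auto
    finally show "(\<Sum>c\<le>reach cs. \<phi> (reach (c # cs))) = code_step \<phi> (reach cs)"
      by (simp add: code_step_def)
  qed
  \<comment> \<open>The induction hypothesis is applied to \<open>code_step \<phi>\<close>, hence
    the arbitrary \<open>\<phi>\<close>: the last tile acts first on the test function.\<close>
  also have "\<dots> = (code_step ^^ (Suc a + d)) \<phi> 0"
    by (simp add: mono.IH funpow_swap1)
  finally show ?case .
next
  case (domino n S a d)
  let ?C = "{cs. cs \<in> codes n \<and> S \<subseteq> rel_positions (<) cs}"
  have fin: "finite ?C" using finite_codes by simp
  have S: "S \<subseteq> {1..<n}" using tiling_subset[OF domino.hyps] .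
  have eq: "{cs. cs \<in> codes (Suc (Suc n)) \<and> insert (Suc n) S \<subseteq> rel_positions (<) cs}
      = (\<lambda>(cs, c). c # 0 # cs) ` (SIGMA cs : ?C. {1..Suc (reach cs)})" (is "?A = ?B")
  proof (intro equalityI subsetI)
    fix cs assume A: "cs \<in> ?A"
    then obtain c c' cs' where c: "cs = c # c' # cs'" "length cs' = n"
      by (auto simp: codes_def length_Suc_conv)
    with A S rel_positions_Cons_Cons[of S cs' "(<)" c c'] have "cs' \<in> ?C" "c' < c"
      by (auto simp: codes_def)
    \<comment> \<open>A positive \<open>c'\<close> would leave reach \<open>c'\<close>,
      contradicting \<open>c' < c\<close>.\<close>
    moreover have "c' = 0 \<and> c \<le> Suc (reach cs')"
      using A c \<open>c' < c\<close> by (auto simp: codes_def split: if_splits)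
    ultimately show "cs \<in> ?B" using c by force
  next
    fix cs assume "cs \<in> ?B"
    then obtain c cs' where c: "cs = c # 0 # cs'" "cs' \<in> ?C" "1 \<le> c" "c \<le> Suc (reach cs')" by auto
    then have "length cs' = n" by (simp add: codes_def)
    with c S rel_positions_Cons_Cons[of S cs' "(<)" c 0]
    have "insert (Suc n) S \<subseteq> rel_positions (<) cs" by simp
    with c show "cs \<in> ?A" by (simp add: codes_def)
  qed
  have "(\<Sum>cs\<in>?A. \<phi> (reach cs))
      = (\<Sum>x\<in>(SIGMA cs : ?C. {1..Suc (reach cs)}). \<phi> (snd x))"
    unfolding eq by (subst sum.reindex) (auto simp: inj_on_def split_beta intro!: sum.cong)
  also have "\<dots> = (\<Sum>cs\<in>?C. code_step \<phi> (reach cs))"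
    using fin by (simp add: sum.Sigma split_beta code_step_def del: sum.cl_ivl_Suc)
  also have "\<dots> = (code_step ^^ (a + Suc d)) \<phi> 0"
    by (simp add: domino.IH funpow_swap1)
  finally show ?case .
qed

text \<open>Consecutive ascents \<open>c'' < c' < c\<close> would make \<open>c'\<close> positive,
  so the reach before \<open>c\<close> would be \<open>c'\<close>, too small for \<open>c\<close>.
  For permutations, two consecutive descents form a 321.\<close>

lemma valid_no_adjacent:
  "valid cs \<Longrightarrow> i \<in> rel_positions (<) cs \<Longrightarrow> Suc i \<notin> rel_positions (<) cs"
proof (induction cs)
  case (Cons c cs)
  have sub: "rel_positions (<) cs \<subseteq> {1..<length cs}" for cs :: "nat list"
    by (rule rel_positions_subset)
  show ?case
  proof (cases cs)
    case Nil
    then show ?thesis by simp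
  next
    case c': (Cons c' cs')
    have *: "j \<in> rel_positions (<) (c # cs) \<longleftrightarrow> (c' < c \<and> j = length cs) \<or> j \<in> rel_positions (<) cs" for j
      using c' by auto
    show ?thesis
    proof
      assume Si: "Suc i \<in> rel_positions (<) (c # cs)"
      show False
      proof (cases "Suc i \<in> rel_positions (<) cs")
        case True
        with sub[of cs] have "Suc i < length cs" by auto
        with Cons.prems(2) have "i \<in> rel_positions (<) cs" unfolding * by auto
        with Cons True show False by simp
      next
        case False
        with Si have i: "Suc i = length cs" "c' < c" unfolding * by auto
        with Cons.prems(2) have "i \<in> rel_positions (<) cs" unfolding * by auto
        moreover from this sub[of cs] have "length cs \<ge> 2" using i by auto
        then obtain c'' cs'' where c'': "cs' = c'' # cs''" using c' by (cases cs') auto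
        have "i \<notin> rel_positions (<) cs'" using sub[of cs'] i(1) c' by auto
        ultimately have "c'' < c'" using c' c'' by (auto split: if_splits)
        with i(2) Cons.prems(1) c' show False by auto
      qed
    qed
  qed
qed simp


subsection \<open>Ballot words with prescribed peaks\<close>

text \<open>Subtraction truncates at 0, but \<open>bal\<close> forbids a \<open>D\<close> there, so
  on ballot words this is the true final height.\<close>

fun height :: "letter list \<Rightarrow> nat" where
  "height [] = 0"
| "height (U # w) = Suc (height w)"
| "height (D # w) = height w - 1"

fun bal :: "letter list \<Rightarrow> bool" where
  "bal [] = True"
| "bal (U # w) = bal w"
| "bal (D # w) = (bal w \<and> 0 < height w)"

lemma height_count: "bal w \<Longrightarrow> height w + count_list w D = count_list w U"
  by (induction w rule: bal.induct) auto

lemma count_letters: "count_list w U + count_list w D = length w"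
proof (induction w)
  case (Cons x w)
  then show ?case by (cases x) auto
qed simp

lemma ballot_snoc:
  "ballot (w @ [x]) \<longleftrightarrow> ballot w \<and> count_list (w @ [x]) D \<le> count_list (w @ [x]) U"
proof -
  have "(\<forall>j\<le>Suc n. P j) \<longleftrightarrow> (\<forall>j\<le>n. P j) \<and> P (Suc n)" for n and P :: "nat \<Rightarrow> bool"
    by (auto simp: le_Suc_eq)
  then show ?thesis unfolding ballot_def by simp
qed

lemma bal_iff: "bal w \<longleftrightarrow> ballot (rev w)"
proof (induction w rule: bal.induct)
  case 1
  then show ?case by (simp add: ballot_def)
next
  case (2 w)
  then show ?case using height_count[of w] by (auto simp: ballot_snoc count_list_append)
next
  case (3 w)
  then show ?case using height_count[of w] by (auto simp: ballot_snoc count_list_append)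
qed

abbreviation peak_positions :: "letter list \<Rightarrow> nat set" where
  "peak_positions \<equiv> rel_positions (\<lambda>x y. x = U \<and> y = D)"

lemma peak_positions_rev: "peak_positions w = peaks (rev w)"
  by (simp add: rel_positions_rev peaks_def)

definition bals :: "nat \<Rightarrow> letter list set" where
  "bals n = {w. length w = n \<and> bal w}"

lemma finite_bals: "finite (bals n)"
proof -
  have UNIV_letter: "(UNIV :: letter set) = {U, D}" using letter.exhaust by blast
  have "finite {w :: letter list. set w \<subseteq> UNIV \<and> length w = n}"
    by (rule finite_lists_length_eq) (simp add: UNIV_letter)
  then show ?thesis by (rule rev_finite_subset) (auto simp: bals_def)
qed

text \<open>Transfer operator of one letter: the paths stay nonnegative, so height 0 has no lower
  neighbour.\<close>

definition ballot_step :: "(nat \<Rightarrow> nat) \<Rightarrow> nat \<Rightarrow> nat" where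
  "ballot_step \<phi> h = \<phi> (Suc h) + (if h = 0 then 0 else \<phi> (h - 1))"

text \<open>A forced peak \<open>UD\<close> is always admissible and returns to the same height, so
  dominoes act as the identity and only the \<open>a\<close> monominoes contribute steps.\<close>

lemma sum_bals_tiling:
  "tiling n S a d \<Longrightarrow>
    (\<Sum>w | w \<in> bals n \<and> S \<subseteq> peak_positions w. \<phi> (height w)) = (ballot_step ^^ a) \<phi> 0"
proof (induction arbitrary: \<phi> rule: tiling.induct)
  case empty
  have "{w. w \<in> bals 0 \<and> {} \<subseteq> peak_positions w} = {[]}" by (auto simp: bals_def)
  then show ?case by simp
next
  case (mono n S a d)
  let ?C = "{w. w \<in> bals n \<and> S \<subseteq> peak_positions w}"
  have fin: "finite ?C" using finite_bals by simp
  then have fin': "finite {w \<in> ?C. 0 < height w}" by (rule rev_finite_subset) auto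
  have S: "S \<subseteq> {1..<n}" using tiling_subset[OF mono.hyps] .
  have eq: "{w. w \<in> bals (Suc n) \<and> S \<subseteq> peak_positions w}
      = (#) U ` ?C \<union> (#) D ` {w \<in> ?C. 0 < height w}" (is "?A = ?B")
  proof (intro equalityI subsetI)
    fix w assume A: "w \<in> ?A"
    then obtain x w' where w: "w = x # w'" "length w' = n" by (auto simp: bals_def length_Suc_conv)
    then have "S \<subseteq> peak_positions w'" using A S rel_positions_Cons[of S w' _ x] by auto
    with A w show "w \<in> ?B" by (cases x) (auto simp: bals_def)
  next
    fix w assume "w \<in> ?B"
    then obtain x w' where w: "w = x # w'" "w' \<in> ?C" "x = D \<longrightarrow> 0 < height w'" by auto
    then have "S \<subseteq> peak_positions w" using S rel_positions_Cons[of S w' _ x] by (auto simp: bals_def)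
    with w show "w \<in> ?A" by (cases x) (auto simp: bals_def)
  qed
  have "(\<Sum>w\<in>?A. \<phi> (height w)) = (\<Sum>w\<in>(#) U ` ?C. \<phi> (height w))
      + (\<Sum>w\<in>(#) D ` {w \<in> ?C. 0 < height w}. \<phi> (height w))"
    unfolding eq using fin fin' by (intro sum.union_disjoint) auto
  also have "\<dots> = (\<Sum>w\<in>?C. \<phi> (Suc (height w))) + (\<Sum>w\<in>{w \<in> ?C. 0 < height w}. \<phi> (height w - 1))"
    by (simp add: sum.reindex)
  also have "(\<Sum>w\<in>{w \<in> ?C. 0 < height w}. \<phi> (height w - 1))
      = (\<Sum>w\<in>?C. if 0 < height w then \<phi> (height w - 1) else 0)"
    by (rule sum.inter_filter[OF fin])
  also have "(\<Sum>w\<in>?C. \<phi> (Suc (height w))) + \<dots> = (\<Sum>w\<in>?C. ballot_step \<phi> (height w))"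
    unfolding sum.distrib[symmetric] by (intro sum.cong) (auto simp: ballot_step_def)
  also have "\<dots> = (ballot_step ^^ Suc a) \<phi> 0"
    by (simp add: mono.IH funpow_swap1)
  finally show ?case .
next
  case (domino n S a d)
  let ?C = "{w. w \<in> bals n \<and> S \<subseteq> peak_positions w}"
  have S: "S \<subseteq> {1..<n}" using tiling_subset[OF domino.hyps] .
  have eq: "{w. w \<in> bals (Suc (Suc n)) \<and> insert (Suc n) S \<subseteq> peak_positions w}
      = (\<lambda>w. D # U # w) ` ?C" (is "?A = ?B")
  proof (intro equalityI subsetI)
    fix w assume A: "w \<in> ?A"
    then obtain x y w' where w: "w = x # y # w'" "length w' = n"
      by (auto simp: bals_def length_Suc_conv)
    with A S rel_positions_Cons_Cons[of S w' "\<lambda>x y. x = U \<and> y = D" x y]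
    show "w \<in> ?B" by (auto simp: bals_def)
  next
    fix w assume "w \<in> ?B"
    then obtain w' where w: "w = D # U # w'" "w' \<in> ?C" by auto
    then have "length w' = n" by (simp add: bals_def)
    with w S rel_positions_Cons_Cons[of S w' "\<lambda>x y. x = U \<and> y = D" D U]
    have "insert (Suc n) S \<subseteq> peak_positions w" by simp
    with w show "w \<in> ?A" by (simp add: bals_def)
  qed
  have "(\<Sum>w\<in>?A. \<phi> (height w)) = (\<Sum>w\<in>?C. \<phi> (height w))"
    unfolding eq by (subst sum.reindex) (auto simp: inj_on_def)
  then show ?case by (simp add: domino.IH)
qed

lemma peak_positions_no_adjacent:
  "i \<in> peak_positions w \<Longrightarrow> Suc i \<notin> peak_positions w"
  by (auto simp: rel_positions_rev)


subsection \<open>Ballot numbers\<close>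

text \<open>The number of nonnegative paths with \<open>l\<close> unit steps from height \<open>h\<close> to height \<open>0\<close>.\<close>

fun ballot_number :: "nat \<Rightarrow> nat \<Rightarrow> nat" where
  "ballot_number 0 h = (if h = 0 then 1 else 0)"
| "ballot_number (Suc l) h =
     ballot_number l (Suc h) + (if h = 0 then 0 else ballot_number l (h - 1))"

text \<open>The recursion of \<open>ballot_number\<close> is \<open>ballot_step\<close> itself. At
  height 0 this glues a path of \<open>a\<close> steps to one of \<open>n\<close> steps that starts
  at the height reached and returns to 0.\<close>

lemma ballot_step_power: "(ballot_step ^^ a) (ballot_number n) = ballot_number (a + n)"
proof (induction a)
  case (Suc a)
  then show ?case by (auto simp: ballot_step_def)
qed simp

lemma ballot_number_diag: "ballot_number h h = 1"
proof -
  have zero: "l < h \<Longrightarrow> ballot_number l h = 0" for l h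
    by (induction l arbitrary: h) auto
  show "ballot_number h h = 1" by (induction h) (auto simp: zero)
qed

text \<open>A path from \<open>h\<close> to 0 with \<open>2 * j + h\<close> steps has
  \<open>j\<close> up-steps. Sorting paths by the height \<open>c\<close> in
  \<open>{1..h + 1}\<close> reached by their first up-step leaves a path from \<open>c\<close> with
  one up-step fewer, which is \<open>code_step\<close>.\<close>

lemma code_step_power: "(code_step ^^ j) (\<lambda>_. 1) h = ballot_number (2 * j + h) h"
proof (induction j arbitrary: h)
  case 0
  then show ?case by (simp add: ballot_number_diag)
next
  case (Suc j)
  have "(code_step ^^ Suc j) (\<lambda>_. 1) h = (\<Sum>c = 1..Suc h. ballot_number (2 * j + c) c)"
    using Suc by (simp add: code_step_def[of "(code_step ^^ j) _"] del: sum.cl_ivl_Suc)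
  also have "\<dots> = ballot_number (2 * Suc j + h) h"
    by (induction h) auto
  finally show ?case .
qed

text \<open>The reflection formula, with \<open>a\<close> the number of up-steps, written additively
  to avoid truncated subtraction; the conditional makes the binomial with lower index -1 vanish. The
  induction is Pascal's rule.\<close>

lemma ballot_number_binomial:
  "h + 2 * a = l \<Longrightarrow>
    ballot_number l h + (if a = 0 then 0 else l choose (a - 1)) = l choose a"
proof (induction l arbitrary: h a)
  case (Suc l)
  show ?case
  proof (cases a)
    case 0
    then show ?thesis using Suc.prems ballot_number_diag[of h] by auto
  next
    case a: (Suc b)
    have 1: "ballot_number l (Suc h) + (if b = 0 then 0 else l choose (b - 1)) = l choose b"
      using Suc.prems a by (intro Suc.IH) auto
    show ?thesis
    proof (cases h)
      case 0
      then have l: "l = Suc (2 * b)" using Suc.prems a by simp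
      \<comment> \<open>At height 0 the lower neighbour is missing; the symmetry of the middle
        binomials compensates for it.\<close>
      have "l choose Suc b = l choose b"
        using binomial_symmetric[of "Suc b" l] l by simp
      with 1 0 a show ?thesis by (cases b) auto
    next
      case (Suc g)
      have "ballot_number l g + (if a = 0 then 0 else l choose (a - 1)) = l choose a"
        using Suc.prems Suc by (intro Suc.IH) auto
      with 1 Suc a show ?thesis by (cases b) auto
    qed
  qed
qed simp

lemma ballot_number_closed_form:
  assumes "2 * a \<le> N"
  shows "real (ballot_number N (N - 2 * a))
    = (real N - 2 * real a + 1) / (real N - real a + 1) * real (N choose a)"
proof (cases a)
  case 0
  then show ?thesis using ballot_number_diag[of N] by simp
next
  case (Suc b)
  have "ballot_number N (N - 2 * a) + (N choose b) = N choose a"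
    using ballot_number_binomial[of "N - 2 * a" a N] assms Suc by simp
  then have 1: "real (ballot_number N (N - 2 * a)) = real (N choose a) - real (N choose b)"
    by (metis add_diff_cancel_right' of_nat_add)
  \<comment> \<open>The ratio of consecutive binomials turns the difference into the stated
    product.\<close>
  have "Suc b * (N choose Suc b) = (N - b) * (N choose b)"
    by (simp only: binomial_absorption binomial_absorb_comp)
  then have "real (Suc b) * real (N choose Suc b) = (real N - real b) * real (N choose b)"
    using assms Suc by (metis of_nat_diff of_nat_mult le_trans mult_2 le_add1 Suc_leD)
  then have "real (N choose b) = real a / (real N - real a + 1) * real (N choose a)"
    using assms Suc by (simp add: field_simps)
  with 1 show ?thesis using assms Suc by (simp add: field_simps)
qed


subsection \<open>Comparison of the two counts\<close>

lemma card_codes_eq_sum_bals: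
  assumes "S \<subseteq> {1..<N}"
  shows "card {cs \<in> codes N. rel_positions (<) cs = S}
    = (\<Sum>w | w \<in> bals N \<and> peak_positions w = S. ballot_number N (height w))"
proof -
  have "(\<Sum>cs | cs \<in> codes N \<and> rel_positions (<) cs = S. 1)
      = (\<Sum>w | w \<in> bals N \<and> peak_positions w = S. ballot_number N (height w))"
  proof (rule sum_fibres_eqI[where E = "{1..<N}"])
    fix S assume S: "S \<subseteq> {1..<N}"
    show "(\<Sum>cs | cs \<in> codes N \<and> S \<subseteq> rel_positions (<) cs. 1)
      = (\<Sum>w | w \<in> bals N \<and> S \<subseteq> peak_positions w. ballot_number N (height w))"
    proof (cases "\<forall>i\<in>S. Suc i \<notin> S")
      case True
      with tiling_exists[OF S] obtain a d where t: "tiling N S a d" by auto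
      \<comment> \<open>The codes give \<open>ballot_number (2 * (a + d)) 0\<close> and the weighted
        ballot words give \<open>ballot_number (a + N) 0\<close>, so equal path lengths
        suffice.\<close>
      have "2 * (a + d) = a + N" using tiling_length[OF t] by simp
      then show ?thesis
        using sum_codes_tiling[OF t, of "\<lambda>_. 1"] sum_bals_tiling[OF t, of "ballot_number N"]
          code_step_power[of "a + d" 0] ballot_step_power[of a N]
        by (simp only: add_0_right)
    next
      case False
      then obtain i where i: "i \<in> S" "Suc i \<in> S" by auto
      then have "{cs. cs \<in> codes N \<and> S \<subseteq> rel_positions (<) cs} = {}"
        using valid_no_adjacent by (fastforce simp: codes_def)
      moreover have "{w. w \<in> bals N \<and> S \<subseteq> peak_positions w} = {}"
        using i peak_positions_no_adjacent by blast
      ultimately show ?thesis by (simp only: sum.empty)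
    qed
  next
    show "rel_positions (<) cs \<subseteq> {1..<N}" if "cs \<in> codes N" for cs
      using that rel_positions_subset[of _ cs] by (simp add: codes_def)
    show "peak_positions w \<subseteq> {1..<N}" if "w \<in> bals N" for w
      using that rel_positions_subset[of _ w] by (simp add: bals_def)
  qed (use assms finite_codes finite_bals in auto)
  then show ?thesis by (simp add: Collect_conj_eq)
qed

lemma K_eq:
  "K N k a = card {w \<in> {w \<in> bals N. peak_positions w = multiples_upto k ((N - 1) div k)}.
     count_list w D = a}"
proof -
  have "{w. length w = N \<and> ballot w \<and> count_list w D = a \<and> peaks w = S}
      = rev ` {w \<in> {w \<in> bals N. peak_positions w = S}. count_list w D = a}" (is "?A = rev ` ?B") for S
  proof (intro equalityI subsetI)
    fix w assume "w \<in> ?A"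
    then have "rev w \<in> ?B" by (simp add: bals_def bal_iff peak_positions_rev)
    then show "w \<in> rev ` ?B" by (rule rev_image_eqI) simp
  qed (auto simp: bals_def bal_iff peak_positions_rev)
  then show ?thesis unfolding K_def by (simp add: card_image)
qed

theorem theorem3p7:
  fixes k m s N :: nat
  assumes "k \<ge> 2" and "1 \<le> s" and "s \<le> k" and "N = m * k + s"
  shows "real (card (des_perms_321 N k)) =
    (\<Sum>a = 0..N div 2. real (K N k a)
       * ((real N - 2 * real a + 1) / (real N - real a + 1)) * real (N choose a))"
proof -
  define S where "S = multiples_upto k ((N - 1) div k)"
  have S: "S \<subseteq> {1..<N}"
  proof
    fix i assume "i \<in> S"
    then obtain j where j: "i = k * j" "1 \<le> j" "j \<le> (N - 1) div k"
      by (auto simp: S_def multiples_upto_def)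
    have "k * j \<le> k * ((N - 1) div k)" using j(3) by (rule mult_le_mono2)
    also have "\<dots> \<le> N - 1" by (rule times_div_less_eq_dividend)
    finally have "k * j \<le> N - 1" .
    moreover have "0 < k * j" using j(2) assms(1) by (intro mult_pos_pos) linarith+
    ultimately show "i \<in> {1..<N}" unfolding j(1) atLeastLessThan_iff by linarith
  qed
  define W where "W = {w \<in> bals N. peak_positions w = S}"
  have "finite W" using finite_bals by (simp add: W_def)
  have W: "2 * count_list w D \<le> N" "height w = N - 2 * count_list w D" if "w \<in> W" for w
    using that height_count[of w] count_letters[of w] by (auto simp: W_def bals_def)
  have "des_perms_321 N k = {p. p permutes {1..N} \<and> Des N p = S \<and> avoids_321 N p}"
    by (auto simp: des_perms_321_def des_perms_def S_def)
  then have "card (des_perms_321 N k) = (\<Sum>w\<in>W. ballot_number N (height w))"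
    using card_avoiding_perms card_codes_eq_sum_bals[OF S] by (simp add: W_def)
  also have "\<dots> = (\<Sum>a = 0..N div 2. \<Sum>w | w \<in> W \<and> count_list w D = a. ballot_number N (height w))"
    using W(1) \<open>finite W\<close>
    by (intro sum.group[symmetric]) (auto simp: less_eq_div_iff_mult_less_eq mult.commute)
  \<comment> \<open>The number of letters \<open>D\<close> fixes the final height, so the weight is
    constant on each fibre, whose size is \<open>K N k a\<close>.\<close>
  also have "\<dots> = (\<Sum>a = 0..N div 2. K N k a * ballot_number N (N - 2 * a))"
    using W(2) by (intro sum.cong) (auto simp: K_eq W_def S_def)
  finally have "real (card (des_perms_321 N k))
      = (\<Sum>a = 0..N div 2. real (K N k a) * real (ballot_number N (N - 2 * a)))"
    by simp
  also have "\<dots> = (\<Sum>a = 0..N div 2. real (K N k a)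
       * ((real N - 2 * real a + 1) / (real N - real a + 1)) * real (N choose a))"
    by (intro sum.cong refl) (simp add: ballot_number_closed_form)
  finally show ?thesis .
qed

end
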